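(* Assume that $\Psi_p(\cdot,h):[t_0,t_f]\to\mathbb{R}_{++}$ is measurable and strictly positive for all $p\in\mathcal{P}$ and all $h$ such that $(h,Q)\in\widetilde\Lambda$ for some $Q$. Also assume that the elastic travel demand function is invertible, with inverse demand functions $\Theta_{ij}[\cdot]$ for all $(i,j)\in\mathcal{W}$. Then a pair $(h^*,Q^* )\in\widetilde\Lambda$ is a dynamic user equilibrium with elastic demand if and only if it solves the variational inequality $$\sum_{p\in\mathcal{P}}\int_{t_0}^{t_f}\Psi_p(t,h^* )\,\big(h_p(t)-h_p^*(t)\big)\,dt-\sum_{(i,j)\in\mathcal{W}}\Theta_{ij}[Q^*]\,\big(Q_{ij}-Q_{ij}^*\big)\;\ge\;0\qquad\text{for all }(h,Q)\in\widetilde\Lambda .$$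
   Context: $[t_0,t_f]\subset\mathbb{R}$ is a fixed compact interval with $t_0<t_f$; $\nu$ is Lebesgue measure on it and all integrals are Lebesgue integrals. $\mathbb{R}_+$ denotes the nonnegative reals and $\mathbb{R}_{++}$ the positive reals. $\mathcal{W}$ is a finite set of origin-destination pairs, $\mathcal{P}$ is a finite set of paths, and for $(i,j)\in\mathcal{W}$, $\mathcal{P}_{ij}\subset\mathcal{P}$ is the set of paths connecting $(i,j)$; each path belongs to exactly one $\mathcal{P}_{ij}$. A vector of path flows (departure rates) is $h=(h_p:p\in\mathcal{P})$ with each $h_p$ a nonnegative square-integrable function on $[t_0,t_f]$. For each path $p$, $\Psi_p(t,h)$ is the effective path delay at departure time $t$ under path flow vector $h$ (the function $\Psi_p(\cdot,h)$ depends on the whole vector $h$). The travel demand vector $Q=(Q_{ij}:(i,j)\in\mathcal{W})\in\mathbb{R}_+^{|\mathcal{W}|}$ is related to the vector of minimum travel costs $v=(v_{ij}:(i,j)\in\mathcal{W})\in\mathbb{R}_{++}^{|\mathcal{W}|}$ by the demand function $F:\mathbb{R}_{++}^{|\mathcal{W}|}\to\mathbb{R}_+^{|\mathcal{W}|}$, $Q=F[v]$. Its inverse is $\Theta=(\Theta_{ij}:(i,j)\in\mathcal{W})$, with $v_{ij}=\Theta_{ij}[Q]\in\mathbb{R}_{++}$. The feasible set is $$\widetilde\Lambda=\Big\{(h,Q)\in\big(L^2[t_0,t_f]\big)^{|\mathcal{P}|}\times\mathbb{R}_+^{|\mathcal{W}|}:\ h\ge 0,\ \sum_{p\in\mathcal{P}_{ij}}\int_{t_0}^{t_f}h_p(t)\,dt=Q_{ij}\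 \ \forall (i,j)\in\mathcal{W}\Big\}.$$ Definition. A pair $(h^*,Q^* )\in\widetilde\Lambda$ is a dynamic user equilibrium with elastic demand if for all $(i,j)\in\mathcal{W}$ and all $p\in\mathcal{P}_{ij}$: for $\nu$-almost every $t\in[t_0,t_f]$, $h_p^*(t)>0$ implies $\Psi_p(t,h^* )=\Theta_{ij}[Q^*]$; and for $\nu$-almost every $t\in[t_0,t_f]$, $\Psi_p(t,h^* )\ge\Theta_{ij}[Q^*]$. *)

theory Defs
  imports "HOL-Analysis.Analysis"
begin

text \<open>
  Vectors indexed by a finite set \<open>I\<close> are elements of \<open>I \<rightarrow>\<^sub>E X\<close>, so that two vectors are equal
  iff their components on \<open>I\<close> agree. Origin-destination pairs have type \<open>'n \<times> 'n\<close>.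
\<close>

text \<open>
  Representatives of the classes in \<open>L\<^sup>2[t0, tf]\<close>. Pointwise conditions on them are imposed almost
  everywhere. An operator \<open>\<Psi>\<close> below takes representatives as arguments and is not required to
  respect a.e. equality, which includes the operators on \<open>L\<^sup>2\<close> as a special case.
\<close>

definition L2 :: "real \<Rightarrow> real \<Rightarrow> (real \<Rightarrow> real) set" where
  "L2 t0 tf = {f \<in> borel_measurable (lebesgue_on {t0..tf}).
                 integrable (lebesgue_on {t0..tf}) (\<lambda>t. (f t)\<^sup>2)}"

definition nonneg_vecs :: "'w set \<Rightarrow> ('w \<Rightarrow> real) set" where
  "nonneg_vecs W = W \<rightarrow>\<^sub>E {0..}"

definition pos_vecs :: "'w set \<Rightarrow> ('w \<Rightarrow> real) set" where
  "pos_vecs W = W \<rightarrow>\<^sub>E {0<..}"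

definition feasible ::
  "real \<Rightarrow> real \<Rightarrow> ('n \<times> 'n) set \<Rightarrow> 'p set \<Rightarrow> ('n \<times> 'n \<Rightarrow> 'p set)
    \<Rightarrow> (('p \<Rightarrow> real \<Rightarrow> real) \<times> ('n \<times> 'n \<Rightarrow> real)) set" where
  "feasible t0 tf W P Pod =
    {(h, Q). h \<in> P \<rightarrow>\<^sub>E L2 t0 tf \<and> Q \<in> nonneg_vecs W \<and>
       (\<forall>p\<in>P. AE t in lebesgue_on {t0..tf}. 0 \<le> h p t) \<and>
       (\<forall>w\<in>W. (\<Sum>p\<in>Pod w. LINT t|lebesgue_on {t0..tf}. h p t) = Q w)}"

definition is_due_elastic ::
  "real \<Rightarrow> real \<Rightarrow> ('n \<times> 'n) set \<Rightarrow> 'p set \<Rightarrow> ('n \<times> 'n \<Rightarrow> 'p set)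
    \<Rightarrow> ('p \<Rightarrow> real \<Rightarrow> ('p \<Rightarrow> real \<Rightarrow> real) \<Rightarrow> real)
    \<Rightarrow> (('n \<times> 'n \<Rightarrow> real) \<Rightarrow> 'n \<times> 'n \<Rightarrow> real)
    \<Rightarrow> ('p \<Rightarrow> real \<Rightarrow> real) \<Rightarrow> ('n \<times> 'n \<Rightarrow> real) \<Rightarrow> bool" where
  "is_due_elastic t0 tf W P Pod \<Psi> \<Theta> h Q \<longleftrightarrow>
    (h, Q) \<in> feasible t0 tf W P Pod \<and>
    (\<forall>w\<in>W. \<forall>p\<in>Pod w.
       (AE t in lebesgue_on {t0..tf}. 0 < h p t \<longrightarrow> \<Psi> p t h = \<Theta> Q w) \<and>
       (AE t in lebesgue_on {t0..tf}. \<Theta> Q w \<le> \<Psi> p t h))"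

text \<open>
  The delays are only measurable and positive, so the integrals in the variational inequality
  need not be finite, and the Bochner integral would then silently be \<open>0\<close>. They are Lebesgue
  integrals with values in the extended reals, defined when the positive or the negative part of
  the integrand has a finite integral. On \<^typ>\<open>ereal\<close> we have \<open>\<infinity> - \<infinity> = \<infinity>\<close> and
  \<open>\<infinity> + (-\<infinity>) = \<infinity>\<close>, so existence must always be stated separately.
\<close>

definition has_ext_integral :: "'a measure \<Rightarrow> ('a \<Rightarrow> real) \<Rightarrow> bool" where
  "has_ext_integral M f \<longleftrightarrow> f \<in> borel_measurable M \<and>
     ((\<integral>\<^sup>+ x. ennreal (f x) \<partial>M) < \<infinity> \<or> (\<integral>\<^sup>+ x. ennreal (- f x) \<partial>M) < \<infinity>)"

definition ext_integral :: "'a measure \<Rightarrow> ('a \<Rightarrow> real) \<Rightarrow> ereal" where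
  "ext_integral M f =
     enn2ereal (\<integral>\<^sup>+ x. ennreal (f x) \<partial>M) - enn2ereal (\<integral>\<^sup>+ x. ennreal (- f x) \<partial>M)"

lemma ext_integral_eq_integral:
  assumes "integrable M f"
  shows "has_ext_integral M f" "ext_integral M f = ereal (integral\<^sup>L M f)"
proof -
  from assms obtain r q where "0 \<le> r" "0 \<le> q"
    "(\<integral>\<^sup>+ x. ennreal (f x) \<partial>M) = ennreal r" "(\<integral>\<^sup>+ x. ennreal (- f x) \<partial>M) = ennreal q"
    "f \<in> borel_measurable M" "integral\<^sup>L M f = r - q"
    by (rule integrableE)
  then show "has_ext_integral M f" "ext_integral M f = ereal (integral\<^sup>L M f)"
    by (simp_all add: has_ext_integral_def ext_integral_def enn2ereal_ennreal)
qed

text \<open>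
  The inequality is asserted only together with its left-hand side being well defined: all the
  integrals exist, and they do not take both values \<open>\<infinity>\<close> and \<open>-\<infinity>\<close>.
\<close>

definition solves_vi ::
  "real \<Rightarrow> real \<Rightarrow> ('n \<times> 'n) set \<Rightarrow> 'p set \<Rightarrow> ('n \<times> 'n \<Rightarrow> 'p set)
    \<Rightarrow> ('p \<Rightarrow> real \<Rightarrow> ('p \<Rightarrow> real \<Rightarrow> real) \<Rightarrow> real)
    \<Rightarrow> (('n \<times> 'n \<Rightarrow> real) \<Rightarrow> 'n \<times> 'n \<Rightarrow> real)
    \<Rightarrow> ('p \<Rightarrow> real \<Rightarrow> real) \<Rightarrow> ('n \<times> 'n \<Rightarrow> real) \<Rightarrow> bool" where
  "solves_vi t0 tf W P Pod \<Psi> \<Theta> h' Q' \<longleftrightarrow>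
    (h', Q') \<in> feasible t0 tf W P Pod \<and>
    (\<forall>(h, Q) \<in> feasible t0 tf W P Pod.
       let J = (\<lambda>p. ext_integral (lebesgue_on {t0..tf}) (\<lambda>t. \<Psi> p t h' * (h p t - h' p t)))
       in (\<forall>p\<in>P. has_ext_integral (lebesgue_on {t0..tf}) (\<lambda>t. \<Psi> p t h' * (h p t - h' p t))) \<and>
          \<not> ((\<exists>p\<in>P. J p = \<infinity>) \<and> (\<exists>p\<in>P. J p = - \<infinity>)) \<and>
          (\<Sum>p\<in>P. J p) - ereal (\<Sum>w\<in>W. \<Theta> Q' w * (Q w - Q' w)) \<ge> 0)"

end

theory Submission
  imports Defs
begin

text \<open>
  Fix \<open>(h', Q')\<close>. For a path \<open>p\<close> serving the pair \<open>w\<close>, write \<open>\<theta>\<close> for the constant \<open>\<Theta> Q' w\<close> and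
  \<open>\<Psi>\<close> for the delay on \<open>p\<close> under \<open>h'\<close>. Since demand is the total
  inflow, \<open>\<Sum>w. \<Theta> Q' w * (Q w - Q' w)\<close> is the sum over all paths of \<open>\<integral> \<theta> (h p - h' p)\<close>, and the
  variational inequality compares \<open>\<integral> \<Psi> (h p - h' p)\<close> with \<open>\<integral> \<theta> (h p - h' p)\<close>, summed over paths.

  At an equilibrium this comparison already holds under the integral sign, path by path:
  \<open>\<Psi> h' = \<theta> h'\<close> and \<open>\<Psi> h \<ge> \<theta> h\<close> almost everywhere. The minorant \<open>\<theta> (h - h')\<close> is integrable, so
  no integral is \<open>-\<infinity>\<close> and the left-hand side is well defined (\<open>due_imp_solves_vi\<close>).

  Conversely, because total demand is elastic, the flow on a single path may be changed while all
  other paths stay as they are: the demand absorbs the change (\<open>feasible_perturb\<close>). The inequality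
  therefore decouples into \<open>\<integral> \<Psi> g \<ge> \<integral> \<theta> g\<close> for every admissible change \<open>g\<close> on one path
  (\<open>solves_vi_perturb\<close>). Adding unit flow where \<open>\<Psi> < \<theta>\<close>, and removing all flow where \<open>\<Psi> > \<theta>\<close>,
  are both choices with \<open>\<Psi> g \<le> \<theta> g\<close> almost everywhere. This forces \<open>\<Psi> g = \<theta> g\<close>
  (\<open>AE_eq_of_integral_le_ext_integral\<close>), which gives the two equilibrium conditions.
\<close>

section \<open>Extended integrals compared with integrable functions\<close>

lemma ext_integral_mono_AE:
  assumes "AE x in M. f x \<le> g x"
  shows "ext_integral M f \<le> ext_integral M g"
proof -
  have "(\<integral>\<^sup>+ x. ennreal (f x) \<partial>M) \<le> (\<integral>\<^sup>+ x. ennreal (g x) \<partial>M)"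
    using assms by (intro nn_integral_mono_AE, elim eventually_mono) (simp add: ennreal_leI)
  moreover have "(\<integral>\<^sup>+ x. ennreal (- g x) \<partial>M) \<le> (\<integral>\<^sup>+ x. ennreal (- f x) \<partial>M)"
    using assms by (intro nn_integral_mono_AE, elim eventually_mono) (simp add: ennreal_leI)
  ultimately show ?thesis
    unfolding ext_integral_def
    by (intro ereal_minus_mono) (simp_all add: less_eq_ennreal.rep_eq)
qed

text \<open>
  An integrable minorant bounds the negative part, so only the value \<open>\<infinity>\<close> remains possible
  outside the reals.
\<close>

lemma integrable_minorant:
  assumes f: "f \<in> borel_measurable M" and k: "integrable M k" and le: "AE x in M. k x \<le> f x"
  shows "has_ext_integral M f" "ereal (integral\<^sup>L M k) \<le> ext_integral M f"
proof -
  have "(\<integral>\<^sup>+ x. ennreal (- f x) \<partial>M) \<le> (\<integral>\<^sup>+ x. ennreal (- k x) \<partial>M)"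
    using le by (intro nn_integral_mono_AE, elim eventually_mono) (simp add: ennreal_leI)
  also have "\<dots> < \<infinity>"
    using k by (elim integrableE) simp
  finally show "has_ext_integral M f"
    using f by (simp add: has_ext_integral_def)
  show "ereal (integral\<^sup>L M k) \<le> ext_integral M f"
    using ext_integral_mono_AE[OF le] ext_integral_eq_integral(2)[OF k] by simp
qed

text \<open>
  The equality case of monotonicity. The lower bound on the extended integral excludes \<open>-\<infinity>\<close>, the
  majorant \<open>k\<close> excludes \<open>\<infinity>\<close>, so \<open>f\<close> is integrable and \<open>k - f \<ge> 0\<close> has integral \<open>0\<close>.
\<close>

lemma AE_eq_of_integral_le_ext_integral:
  assumes f: "f \<in> borel_measurable M" and k: "integrable M k"
    and le: "AE x in M. f x \<le> k x"
    and ge: "ereal (integral\<^sup>L M k) \<le> ext_integral M f"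
  shows "AE x in M. f x = k x"
proof -
  have "(\<integral>\<^sup>+ x. ennreal (f x) \<partial>M) \<le> (\<integral>\<^sup>+ x. ennreal (k x) \<partial>M)"
    using le by (intro nn_integral_mono_AE, elim eventually_mono) (simp add: ennreal_leI)
  also have "\<dots> < \<infinity>"
    using k by (elim integrableE) simp
  finally have pos: "(\<integral>\<^sup>+ x. ennreal (f x) \<partial>M) < \<infinity>" .
  have neg: "(\<integral>\<^sup>+ x. ennreal (- f x) \<partial>M) < \<infinity>"
  proof (rule ccontr)
    assume "\<not> ?thesis"
    then have "(\<integral>\<^sup>+ x. ennreal (- f x) \<partial>M) = \<infinity>"
      by (simp add: not_less top_unique)
    moreover obtain r where "0 \<le> r" "(\<integral>\<^sup>+ x. ennreal (f x) \<partial>M) = ennreal r"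
      using pos by (cases "\<integral>\<^sup>+ x. ennreal (f x) \<partial>M") auto
    ultimately have "ext_integral M f = - \<infinity>"
      by (simp add: ext_integral_def enn2ereal_ennreal)
    with ge show False by simp
  qed
  have int_f: "integrable M f"
    using f pos neg by (simp add: real_integrable_def less_top)
  then have "integral\<^sup>L M k \<le> integral\<^sup>L M f"
    using ge ext_integral_eq_integral(2) by fastforce
  moreover have "0 \<le> integral\<^sup>L M (\<lambda>x. k x - f x)"
    using le by (intro integral_nonneg_AE) auto
  ultimately have "integral\<^sup>L M (\<lambda>x. k x - f x) = 0"
    using int_f k by simp
  then have "AE x in M. k x - f x = 0"
    using integral_nonneg_eq_0_iff_AE[of M "\<lambda>x. k x - f x"] le int_f k by auto
  then show ?thesis by auto
qed

section \<open>Square-integrable functions on a compact interval\<close>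

lemma L2_imp_integrable:
  assumes "f \<in> L2 a b"
  shows "integrable (lebesgue_on {a..b}) f"
proof (rule Bochner_Integration.integrable_bound)
  show "integrable (lebesgue_on {a..b}) (\<lambda>t. 1 + (f t)\<^sup>2)"
    using assms by (auto simp: L2_def integrable_const_ivl)
  have "\<bar>x\<bar> \<le> 1 + x\<^sup>2" for x :: real
    using sum_power2_ge_zero[of "\<bar>x\<bar> - 1" 0] by (simp add: power2_eq_square algebra_simps)
  then show "AE t in lebesgue_on {a..b}. norm (f t) \<le> norm (1 + (f t)\<^sup>2)"
    by simp
qed (use assms in \<open>simp add: L2_def\<close>)

lemma L2_add:
  assumes "f \<in> L2 a b" "g \<in> L2 a b"
  shows "(\<lambda>t. f t + g t) \<in> L2 a b"
proof -
  have meas: "f \<in> borel_measurable (lebesgue_on {a..b})" "g \<in> borel_measurable (lebesgue_on {a..b})"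
    using assms by (auto simp: L2_def)
  have "integrable (lebesgue_on {a..b}) (\<lambda>t. (f t + g t)\<^sup>2)"
  proof (rule Bochner_Integration.integrable_bound)
    show "integrable (lebesgue_on {a..b}) (\<lambda>t. 2 * (f t)\<^sup>2 + 2 * (g t)\<^sup>2)"
      using assms by (auto simp: L2_def)
    have "(x + y)\<^sup>2 \<le> 2 * x\<^sup>2 + 2 * y\<^sup>2" for x y :: real
      using zero_le_power2[of "x - y"] by (simp add: power2_eq_square algebra_simps)
    then show "AE t in lebesgue_on {a..b}.
        norm ((f t + g t)\<^sup>2) \<le> norm (2 * (f t)\<^sup>2 + 2 * (g t)\<^sup>2)"
      by simp
  qed (use meas in measurable)
  with meas show ?thesis by (simp add: L2_def)
qed

lemma L2_bounded_by:
  assumes "f \<in> L2 a b" "g \<in> borel_measurable (lebesgue_on {a..b})" "\<And>t. \<bar>g t\<bar> \<le> \<bar>f t\<bar>"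
  shows "g \<in> L2 a b"
proof -
  have "integrable (lebesgue_on {a..b}) (\<lambda>t. (g t)\<^sup>2)"
  proof (rule Bochner_Integration.integrable_bound)
    show "integrable (lebesgue_on {a..b}) (\<lambda>t. (f t)\<^sup>2)"
      using assms(1) by (simp add: L2_def)
    show "AE t in lebesgue_on {a..b}. norm ((g t)\<^sup>2) \<le> norm ((f t)\<^sup>2)"
      using assms(3) by (simp add: abs_le_square_iff)
  qed (use assms(2) in measurable)
  with assms(2) show ?thesis by (simp add: L2_def)
qed

lemma L2_const: "(\<lambda>t. c) \<in> L2 a b"
  by (simp add: L2_def integrable_const_ivl)

section \<open>Feasible flows and demands\<close>

lemma feasibleD:
  assumes "(h, Q) \<in> feasible t0 tf W P Pod"
  shows "\<And>p. p \<in> P \<Longrightarrow> h p \<in> L2 t0 tf"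
    and "\<And>p. p \<in> P \<Longrightarrow> AE t in lebesgue_on {t0..tf}. 0 \<le> h p t"
    and "\<And>w. w \<in> W \<Longrightarrow> (\<Sum>p\<in>Pod w. LINT t|lebesgue_on {t0..tf}. h p t) = Q w"
  using assms by (auto simp: feasible_def)

text \<open>
  The demand of the pair served by \<open>p\<close> is raised by exactly the flow added on \<open>p\<close>, so the change
  needs no compensation on another path.
\<close>

lemma feasible_perturb:
  assumes finP: "finite P"
    and sub: "\<And>w. w \<in> W \<Longrightarrow> Pod w \<subseteq> P"
    and uniq: "\<And>p. p \<in> P \<Longrightarrow> \<exists>!w. w \<in> W \<and> p \<in> Pod w"
    and feas: "(h, Q) \<in> feasible t0 tf W P Pod"
    and w: "w \<in> W" and p: "p \<in> Pod w"
    and g: "g \<in> L2 t0 tf"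
    and nonneg: "AE t in lebesgue_on {t0..tf}. 0 \<le> h p t + g t"
  shows "(h(p := \<lambda>t. h p t + g t), Q(w := Q w + (LINT t|lebesgue_on {t0..tf}. g t)))
           \<in> feasible t0 tf W P Pod"
    (is "(?h, ?Q) \<in> _")
proof -
  let ?M = "lebesgue_on {t0..tf}"
  have pP: "p \<in> P" using sub[OF w] p by blast
  have hPiE: "h \<in> P \<rightarrow>\<^sub>E L2 t0 tf" and QPiE: "Q \<in> W \<rightarrow>\<^sub>E {0..}"
    using feas by (auto simp: feasible_def nonneg_vecs_def)
  have h_in: "?h \<in> P \<rightarrow>\<^sub>E L2 t0 tf"
    using hPiE pP L2_add[OF feasibleD(1)[OF feas pP] g] by (auto simp: PiE_iff extensional_def)
  have h_nonneg: "AE t in ?M. 0 \<le> ?h q t" if "q \<in> P" for q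
    using nonneg feasibleD(2)[OF feas that] by (cases "q = p") auto
  have total: "(\<Sum>q\<in>Pod u. LINT t|?M. ?h q t) = ?Q u" if u: "u \<in> W" for u
  proof -
    have fin: "finite (Pod u)" using sub u finP finite_subset by blast
    have "(LINT t|?M. ?h q t) = (LINT t|?M. h q t) + (if q = p then (LINT t|?M. g t) else 0)"
      if "q \<in> Pod u" for q
      using L2_imp_integrable[OF g] L2_imp_integrable[OF feasibleD(1)[OF feas pP]] by simp
    then have "(\<Sum>q\<in>Pod u. LINT t|?M. ?h q t)
        = (\<Sum>q\<in>Pod u. LINT t|?M. h q t) + (if p \<in> Pod u then (LINT t|?M. g t) else 0)"
      using fin by (simp add: sum.distrib cong: sum.cong)
    moreover have "p \<in> Pod u \<longleftrightarrow> u = w"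
      using uniq[OF pP] u w p by auto
    ultimately show ?thesis
      using feasibleD(3)[OF feas u] by simp
  qed
  have "0 \<le> ?Q w"
  proof -
    have "0 \<le> (\<Sum>q\<in>Pod w. LINT t|?M. ?h q t)"
      using h_nonneg sub[OF w] by (intro sum_nonneg integral_nonneg_AE) blast
    then show ?thesis using total[OF w] by simp
  qed
  then have "?Q \<in> nonneg_vecs W"
    using QPiE w by (auto simp: PiE_iff extensional_def nonneg_vecs_def)
  with h_in h_nonneg total show ?thesis
    by (auto simp: feasible_def)
qed

lemma sum_paths_by_pair:
  assumes "finite W" "finite P"
    and sub: "\<And>w. w \<in> W \<Longrightarrow> Pod w \<subseteq> P"
    and uniq: "\<And>p. p \<in> P \<Longrightarrow> \<exists>!w. w \<in> W \<and> p \<in> Pod w"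
  shows "(\<Sum>p\<in>P. a p) = (\<Sum>w\<in>W. \<Sum>p\<in>Pod w. a p)"
proof -
  have "P = (\<Union>w\<in>W. Pod w)" using sub uniq by blast
  moreover have "\<forall>u\<in>W. \<forall>w\<in>W. u \<noteq> w \<longrightarrow> Pod u \<inter> Pod w = {}"
    using sub uniq by blast
  moreover have "\<forall>w\<in>W. finite (Pod w)"
    using sub \<open>finite P\<close> by (blast intro: finite_subset)
  ultimately show ?thesis
    using sum.UNION_disjoint[of W Pod a] \<open>finite W\<close> by simp
qed

lemma ereal_diff_nonneg_iff: "0 \<le> x - ereal c \<longleftrightarrow> ereal c \<le> x"
  by (cases x) auto

section \<open>Equilibria and the variational inequality\<close>

lemma due_imp_solves_vi:
  assumes finW: "finite W" and finP: "finite P"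
    and sub: "\<And>w. w \<in> W \<Longrightarrow> Pod w \<subseteq> P"
    and uniq: "\<And>p. p \<in> P \<Longrightarrow> \<exists>!w. w \<in> W \<and> p \<in> Pod w"
    and meas: "\<And>p. p \<in> P \<Longrightarrow> (\<lambda>t. \<Psi> p t h') \<in> borel_measurable (lebesgue_on {t0..tf})"
    and due: "is_due_elastic t0 tf W P Pod \<Psi> \<Theta> h' Q'"
  shows "solves_vi t0 tf W P Pod \<Psi> \<Theta> h' Q'"
proof -
  let ?M = "lebesgue_on {t0..tf}"
  have feas': "(h', Q') \<in> feasible t0 tf W P Pod"
    using due by (simp add: is_due_elastic_def)
  have "(\<forall>p\<in>P. has_ext_integral ?M (\<lambda>t. \<Psi> p t h' * (h p t - h' p t))) \<and>
        \<not> ((\<exists>p\<in>P. ext_integral ?M (\<lambda>t. \<Psi> p t h' * (h p t - h' p t)) = \<infinity>) \<and>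
           (\<exists>p\<in>P. ext_integral ?M (\<lambda>t. \<Psi> p t h' * (h p t - h' p t)) = - \<infinity>)) \<and>
        (\<Sum>p\<in>P. ext_integral ?M (\<lambda>t. \<Psi> p t h' * (h p t - h' p t)))
          - ereal (\<Sum>w\<in>W. \<Theta> Q' w * (Q w - Q' w)) \<ge> 0"
    if feas: "(h, Q) \<in> feasible t0 tf W P Pod" for h Q
  proof -
    define f where "f p t = \<Psi> p t h' * (h p t - h' p t)" for p t
    define d where "d p = (LINT t|?M. h p t) - (LINT t|?M. h' p t)" for p
    have path: "has_ext_integral ?M (f p) \<and> ereal (\<Theta> Q' w * d p) \<le> ext_integral ?M (f p)"
      if w: "w \<in> W" and p: "p \<in> Pod w" for w p
    proof -
      have pP: "p \<in> P" using sub[OF w] p by blast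
      have int: "integrable ?M (h p)" "integrable ?M (h' p)"
        using feasibleD(1)[OF feas pP] feasibleD(1)[OF feas' pP] by (auto intro: L2_imp_integrable)
      have eq: "AE t in ?M. 0 < h' p t \<longrightarrow> \<Psi> p t h' = \<Theta> Q' w"
        and ge: "AE t in ?M. \<Theta> Q' w \<le> \<Psi> p t h'"
        using due w p by (auto simp: is_due_elastic_def)
      \<comment> \<open>Where \<open>h' p\<close> vanishes, only \<open>\<Psi> \<ge> \<theta>\<close> and \<open>h p \<ge> 0\<close> are available; elsewhere \<open>\<Psi> = \<theta>\<close>,
          so the sign of \<open>h p - h' p\<close> is irrelevant.\<close>
      have "AE t in ?M. \<Theta> Q' w * (h p t - h' p t) \<le> f p t"
        using eq ge feasibleD(2)[OF feas pP] feasibleD(2)[OF feas' pP]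
      proof eventually_elim
        case (elim t)
        then show ?case
          by (cases "h' p t = 0") (auto simp: f_def intro: mult_right_mono)
      qed
      moreover have "integrable ?M (\<lambda>t. \<Theta> Q' w * (h p t - h' p t))"
        using int by simp
      moreover have "f p \<in> borel_measurable ?M"
        unfolding f_def using meas[OF pP] int by measurable
      moreover have "(LINT t|?M. \<Theta> Q' w * (h p t - h' p t)) = \<Theta> Q' w * d p"
        using int by (simp add: d_def)
      ultimately show ?thesis
        using integrable_minorant[of "f p" ?M "\<lambda>t. \<Theta> Q' w * (h p t - h' p t)"] by metis
    qed
    define pair where "pair p = (THE w. w \<in> W \<and> p \<in> Pod w)" for p
    have pair: "pair p \<in> W \<and> p \<in> Pod (pair p)" if "p \<in> P" for p
      unfolding pair_def by (rule theI'[OF uniq[OF that]])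
    have pair_eq: "pair p = w" if "w \<in> W" "p \<in> Pod w" for w p
      using pair uniq sub that by blast
    have ex: "has_ext_integral ?M (f p)"
      and le: "ereal (\<Theta> Q' (pair p) * d p) \<le> ext_integral ?M (f p)" if "p \<in> P" for p
      using path pair[OF that] by blast+
    have no_minf: "ext_integral ?M (f p) \<noteq> - \<infinity>" if "p \<in> P" for p
      using le[OF that] by auto
    have "(\<Sum>w\<in>W. \<Theta> Q' w * (Q w - Q' w)) = (\<Sum>w\<in>W. \<Sum>p\<in>Pod w. \<Theta> Q' (pair p) * d p)"
    proof (rule sum.cong[OF refl])
      fix w assume w: "w \<in> W"
      have "Q w - Q' w = (\<Sum>p\<in>Pod w. d p)"
        using feasibleD(3)[OF feas w] feasibleD(3)[OF feas' w] by (simp add: d_def sum_subtractf)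
      then show "\<Theta> Q' w * (Q w - Q' w) = (\<Sum>p\<in>Pod w. \<Theta> Q' (pair p) * d p)"
        using pair_eq[OF w] by (simp add: sum_distrib_left cong: sum.cong)
    qed
    also have "\<dots> = (\<Sum>p\<in>P. \<Theta> Q' (pair p) * d p)"
      using sum_paths_by_pair[OF finW finP sub uniq] by metis
    finally have "ereal (\<Sum>w\<in>W. \<Theta> Q' w * (Q w - Q' w)) = (\<Sum>p\<in>P. ereal (\<Theta> Q' (pair p) * d p))"
      by simp
    also have "\<dots> \<le> (\<Sum>p\<in>P. ext_integral ?M (f p))"
      using le by (rule sum_mono)
    finally show ?thesis
      using ex no_minf unfolding f_def by (auto simp: ereal_diff_nonneg_iff)
  qed
  with feas' show ?thesis
    unfolding solves_vi_def Let_def by blast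
qed

text \<open>
  Testing with a flow that differs from \<open>h'\<close> on one path makes every other summand vanish on both
  sides, which turns the inequality for sums into one for each path.
\<close>

lemma solves_vi_perturb:
  assumes finW: "finite W" and finP: "finite P"
    and sub: "\<And>w. w \<in> W \<Longrightarrow> Pod w \<subseteq> P"
    and uniq: "\<And>p. p \<in> P \<Longrightarrow> \<exists>!w. w \<in> W \<and> p \<in> Pod w"
    and vi: "solves_vi t0 tf W P Pod \<Psi> \<Theta> h' Q'"
    and w: "w \<in> W" and p: "p \<in> Pod w"
    and g: "g \<in> L2 t0 tf"
    and nonneg: "AE t in lebesgue_on {t0..tf}. 0 \<le> h' p t + g t"
  shows "ereal (LINT t|lebesgue_on {t0..tf}. \<Theta> Q' w * g t)
           \<le> ext_integral (lebesgue_on {t0..tf}) (\<lambda>t. \<Psi> p t h' * g t)"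
proof -
  let ?M = "lebesgue_on {t0..tf}"
  define h where "h = h'(p := \<lambda>t. h' p t + g t)"
  define Q where "Q = Q'(w := Q' w + (LINT t|?M. g t))"
  have feas': "(h', Q') \<in> feasible t0 tf W P Pod"
    using vi by (simp add: solves_vi_def)
  have pP: "p \<in> P" using sub[OF w] p by blast
  have "(h, Q) \<in> feasible t0 tf W P Pod"
    unfolding h_def Q_def by (rule feasible_perturb[OF finP sub uniq feas' w p g nonneg])
  then have "ereal (\<Sum>u\<in>W. \<Theta> Q' u * (Q u - Q' u))
      \<le> (\<Sum>q\<in>P. ext_integral ?M (\<lambda>t. \<Psi> q t h' * (h q t - h' q t)))"
    using vi unfolding solves_vi_def Let_def by (auto simp: ereal_diff_nonneg_iff)
  also have "\<dots> = (\<Sum>q\<in>P. if q = p then ext_integral ?M (\<lambda>t. \<Psi> p t h' * g t) else 0)"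
    by (intro sum.cong refl) (auto simp: h_def ext_integral_def zero_ennreal.rep_eq)
  also have "\<dots> = ext_integral ?M (\<lambda>t. \<Psi> p t h' * g t)"
    using finP pP by simp
  also have "(\<Sum>u\<in>W. \<Theta> Q' u * (Q u - Q' u))
      = (\<Sum>u\<in>W. if u = w then \<Theta> Q' w * (LINT t|?M. g t) else 0)"
    by (intro sum.cong refl) (auto simp: Q_def)
  also have "\<dots> = \<Theta> Q' w * (LINT t|?M. g t)"
    using finW w by simp
  finally show ?thesis
    by simp
qed

lemma solves_vi_imp_due:
  assumes finW: "finite W" and finP: "finite P"
    and sub: "\<And>w. w \<in> W \<Longrightarrow> Pod w \<subseteq> P"
    and uniq: "\<And>p. p \<in> P \<Longrightarrow> \<exists>!w. w \<in> W \<and> p \<in> Pod w"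
    and meas: "\<And>p. p \<in> P \<Longrightarrow> (\<lambda>t. \<Psi> p t h') \<in> borel_measurable (lebesgue_on {t0..tf})"
    and vi: "solves_vi t0 tf W P Pod \<Psi> \<Theta> h' Q'"
  shows "is_due_elastic t0 tf W P Pod \<Psi> \<Theta> h' Q'"
proof -
  let ?M = "lebesgue_on {t0..tf}"
  have feas': "(h', Q') \<in> feasible t0 tf W P Pod"
    using vi by (simp add: solves_vi_def)
  have "(AE t in ?M. 0 < h' p t \<longrightarrow> \<Psi> p t h' = \<Theta> Q' w) \<and> (AE t in ?M. \<Theta> Q' w \<le> \<Psi> p t h')"
    if w: "w \<in> W" and p: "p \<in> Pod w" for w p
  proof -
    have pP: "p \<in> P" using sub[OF w] p by blast
    note [measurable] = meas[OF pP]
    have L2h: "h' p \<in> L2 t0 tf" and h_nonneg: "AE t in ?M. 0 \<le> h' p t"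
      using feasibleD(1,2)[OF feas' pP] by auto
    have [measurable]: "h' p \<in> borel_measurable ?M"
      using L2h by (simp add: L2_def)
    have tight: "AE t in ?M. \<Psi> p t h' * g t = \<Theta> Q' w * g t"
      if g: "g \<in> L2 t0 tf" and nonneg: "AE t in ?M. 0 \<le> h' p t + g t"
        and le: "AE t in ?M. \<Psi> p t h' * g t \<le> \<Theta> Q' w * g t" for g
    proof (rule AE_eq_of_integral_le_ext_integral[OF _ _ le])
      have [measurable]: "g \<in> borel_measurable ?M" using g by (simp add: L2_def)
      show "(\<lambda>t. \<Psi> p t h' * g t) \<in> borel_measurable ?M" by measurable
      show "integrable ?M (\<lambda>t. \<Theta> Q' w * g t)" using L2_imp_integrable[OF g] by simp
      show "ereal (LINT t|?M. \<Theta> Q' w * g t) \<le> ext_integral ?M (\<lambda>t. \<Psi> p t h' * g t)"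
        by (rule solves_vi_perturb[OF finW finP sub uniq vi w p g nonneg])
    qed
    have ge: "AE t in ?M. \<Theta> Q' w \<le> \<Psi> p t h'"
    proof -
      define g :: "real \<Rightarrow> real" where "g t = (if \<Psi> p t h' < \<Theta> Q' w then 1 else 0)" for t
      have "g \<in> L2 t0 tf"
        unfolding g_def by (rule L2_bounded_by[OF L2_const[of 1]]) auto
      moreover have "AE t in ?M. 0 \<le> h' p t + g t"
        using h_nonneg by eventually_elim (simp add: g_def)
      moreover have "AE t in ?M. \<Psi> p t h' * g t \<le> \<Theta> Q' w * g t"
        by (simp add: g_def)
      ultimately have "AE t in ?M. \<Psi> p t h' * g t = \<Theta> Q' w * g t"
        by (rule tight)
      then show ?thesis
        by eventually_elim (auto simp: g_def split: if_splits)
    qed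
    have "AE t in ?M. 0 < h' p t \<longrightarrow> \<Psi> p t h' = \<Theta> Q' w"
    proof -
      define g where "g t = (if \<Theta> Q' w < \<Psi> p t h' then - h' p t else 0)" for t
      have "g \<in> L2 t0 tf"
        unfolding g_def by (rule L2_bounded_by[OF L2h]) auto
      moreover have "AE t in ?M. 0 \<le> h' p t + g t"
        using h_nonneg by eventually_elim (simp add: g_def)
      moreover have "AE t in ?M. \<Psi> p t h' * g t \<le> \<Theta> Q' w * g t"
        using h_nonneg by eventually_elim (auto simp: g_def intro: mult_right_mono)
      ultimately have "AE t in ?M. \<Psi> p t h' * g t = \<Theta> Q' w * g t"
        by (rule tight)
      then show ?thesis
        using ge by eventually_elim (auto simp: g_def split: if_splits)
    qed
    with ge show ?thesis by blast
  qed
  with feas' show ?thesis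
    unfolding is_due_elastic_def by blast
qed

theorem theorem3p1:
  fixes t0 tf :: real
    and W :: "('n \<times> 'n) set" and P :: "'p set" and Pod :: "'n \<times> 'n \<Rightarrow> 'p set"
    and \<Psi> :: "'p \<Rightarrow> real \<Rightarrow> ('p \<Rightarrow> real \<Rightarrow> real) \<Rightarrow> real"
    and F \<Theta> :: "('n \<times> 'n \<Rightarrow> real) \<Rightarrow> 'n \<times> 'n \<Rightarrow> real"
    and h' :: "'p \<Rightarrow> real \<Rightarrow> real" and Q' :: "'n \<times> 'n \<Rightarrow> real"
  assumes "t0 < tf"
    and "finite W" and "finite P"
    and "\<And>w. w \<in> W \<Longrightarrow> Pod w \<subseteq> P"
    and "\<And>p. p \<in> P \<Longrightarrow> \<exists>!w. w \<in> W \<and> p \<in> Pod w"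
    and "\<And>p h Q. p \<in> P \<Longrightarrow> (h, Q) \<in> feasible t0 tf W P Pod \<Longrightarrow>
           (\<lambda>t. \<Psi> p t h) \<in> borel_measurable (lebesgue_on {t0..tf})"
    and "\<And>p h Q t. p \<in> P \<Longrightarrow> (h, Q) \<in> feasible t0 tf W P Pod \<Longrightarrow> t \<in> {t0..tf} \<Longrightarrow> 0 < \<Psi> p t h"
    and "bij_betw F (pos_vecs W) (nonneg_vecs W)"
    and "\<And>v. v \<in> pos_vecs W \<Longrightarrow> \<Theta> (F v) = v"
    and "(h', Q') \<in> feasible t0 tf W P Pod"
  shows "is_due_elastic t0 tf W P Pod \<Psi> \<Theta> h' Q' \<longleftrightarrow> solves_vi t0 tf W P Pod \<Psi> \<Theta> h' Q'"
proof -
  have meas: "\<And>p. p \<in> P \<Longrightarrow> (\<lambda>t. \<Psi> p t h') \<in> borel_measurable (lebesgue_on {t0..tf})"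
    using assms(6,10) by blast
  show ?thesis
    using due_imp_solves_vi[of W P Pod \<Psi> h' t0 tf \<Theta> Q', OF assms(2-5) meas]
      solves_vi_imp_due[of W P Pod \<Psi> h' t0 tf \<Theta> Q', OF assms(2-5) meas]
    by blast
qed

end
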